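(* Let $f:\mathbb{S}^1\to\mathbb{R}$ be of class $C^2$ and $H(I,\varphi)=I^2/2+f(\varphi)$ on $\mathbb{R}\times\mathbb{S}^1$. With $\gamma_k,\gamma_0,c_k,c,u_k,u_0,\sigma_k,\bar H_k$ as defined in the context: (i) For any $\tilde I>0$, the functions $u_k(\tilde I,\varphi)$ are smooth, have zero average over $[0,2\pi]$ and solve the Euler–Lagrange equation of the functional $u\mapsto\int_0^{2\pi}e^{kH(\tilde I+\frac{du}{d\varphi},\varphi)}d\varphi$, namely $$\frac{d}{d\varphi}\Big(\sigma_k(\tilde I,\varphi)\ \frac{\partial H}{\partial I}\big(\tilde I+\tfrac{\partial u_k}{\partial\varphi}(\tilde I,\varphi),\varphi\big)\Big)=0 .$$ Moreover, for any $\tilde I>0$, $u_k(\tilde I,\varphi)$ converges to $u_0(\tilde I,\varphi)$ as $k\to+\infty$, uniformly on $\mathbb{S}^1$. (ii) The functions $\gamma_k(c,\varphi)$ are smooth and, for any fixed $c_*\in\mathbb{R}$, converge as $k\to+\infty$ to $\gamma_0(c,\varphi)$ uniformly on $(-\infty,c_*]\times\mathbb{S}^1$. (iii) The functions $c_k(\tilde I)$ converge pointwise to $c(\tilde I)$, i.e. for every $\tilde I>0$, $\lim_{k\to+\infty}c_k(\tilde I)=c(\tilde I)$. (iv) The functions $\sigma_k$ and $\bar H_k$ satisfy, for every $\tilde I>0$, $$\lim_{k\to+\infty}\int_0^{2\pi}H\Big(\tilde I+\frac{\partial u_k}{\partial\varphi}(\tilde I,\varphi),\varphi\Big)\sigma_k(\tilde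 I,\varphi)\,d\varphi=\bar H(\tilde I)=\lim_{k\to+\infty}\bar H_k(\tilde I),$$ where $\bar H(\tilde I):=c(\tilde I)$ if $c(\tilde I)>\max f$ and $\bar H(\tilde I):=\max f$ otherwise.
   Context: $\mathbb{S}^1=\mathbb{R}/2\pi\mathbb{Z}$; $k\ge 1$ is an integer. $W:[0,+\infty)\to[0,+\infty)$ is the (real, increasing) Lambert function, defined by $z=W(z)e^{W(z)}$. Given $f\in C^2(\mathbb{S}^1)$: $\gamma_k(c,\varphi):=\sqrt{\dfrac{W(e^{2(c-f(\varphi))k}\,k)}{k}}$ for $c\in\mathbb{R}$, $\varphi\in\mathbb{S}^1$; $\gamma_0(c,\varphi):=\sqrt{2(c-f(\varphi))}$ if $c>f(\varphi)$ and $\gamma_0(c,\varphi):=0$ otherwise. For $\tilde I>0$, $c_k(\tilde I)\in\mathbb{R}$ is the unique $c$ with $\tilde I=\frac1{2\pi}\int_0^{2\pi}\gamma_k(c,\varphi)d\varphi$, and $c(\tilde I)\in\mathbb{R}$ is the unique $c$ with $\tilde I=\frac1{2\pi}\int_0^{2\pi}\gamma_0(c,\varphi)d\varphi$ (so $c(\tilde I)>\min f$). For $\tilde I>0$, $\varphi\in\mathbb{S}^1$ (represented in $[0,2\pi]$): $$u_k(\tilde I,\varphi):=\tilde I(\pi-\varphi)-\frac1{2\pi}\int_0^{2\pi}\!\!\int_0^y\gamma_k(c_k(\tilde I),x)\,dx\,dy+\int_0^\varphi\gamma_k(c_k(\tilde I),x)\,dx,$$ $$u_0(\tilde I,\varphi):=\tilde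 I(\pi-\varphi)-\frac1{2\pi}\int_0^{2\pi}\!\!\int_0^y\gamma_0(c(\tilde I),x)\,dx\,dy+\int_0^\varphi\gamma_0(c(\tilde I),x)\,dx,$$ $$\sigma_k(\tilde I,\varphi):=\frac{1/\gamma_k(c_k(\tilde I),\varphi)}{\int_0^{2\pi}\frac{dx}{\gamma_k(c_k(\tilde I),x)}},\qquad \bar H_k(\tilde I):=c_k(\tilde I)+\frac1k\log\int_0^{2\pi}\frac{d\varphi}{\gamma_k(c_k(\tilde I),\varphi)}.$$ With these definitions $\sigma_k(\tilde I,\varphi)=e^{k(H(\tilde I+\frac{\partial u_k}{\partial\varphi},\varphi)-\bar H_k(\tilde I))}$, so the equation in (i) is, up to a constant factor depending on $\tilde I$ and $k$, the Euler–Lagrange equation with $e^{kH(\tilde I+\partial u_k/\partial\varphi,\varphi)}$ in place of $\sigma_k$.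
   Formalization: "Smooth" as C^∞ in φ fails for f merely C²; it is replaced by: if f is C^m, then u_k is C^{m+1} in φ and γ_k is jointly C^m in (c,φ) (so C^∞ when f is), with γ_k always C^∞ in c. *)

theory Defs
  imports "HOL-Analysis.Analysis" "HOL-Library.Real_Mod" "HOL-Library.Periodic_Fun"
begin

text \<open>
  Functions on the circle \<open>\<real>/2\<pi>\<int>\<close> are represented by \<open>2\<pi>\<close>-periodic functions on the real line, so
  regularity on the circle is regularity on all of \<open>\<real>\<close> and uniformity on the circle is
  uniformity on \<open>UNIV\<close>.
\<close>

text \<open>
  \<open>C_diff m g\<close>: \<open>g\<close> is of class \<open>C\<^sup>m\<close> on the whole space. The directional derivatives are those of
  the total derivative; in finite dimension this is the usual notion.
\<close>

primrec C_diff :: "nat \<Rightarrow> ('a::real_normed_vector \<Rightarrow> 'b::real_normed_vector) \<Rightarrow> bool" where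
  "C_diff 0 g \<longleftrightarrow> continuous_on UNIV g"
| "C_diff (Suc m) g \<longleftrightarrow>
     (\<forall>x. g differentiable (at x)) \<and> (\<forall>v. C_diff m (\<lambda>x. frechet_derivative g (at x) v))"

definition C_infty :: "('a::real_normed_vector \<Rightarrow> 'b::real_normed_vector) \<Rightarrow> bool" where
  "C_infty g \<longleftrightarrow> (\<forall>m. C_diff m g)"

text \<open>
  The Euler--Lagrange equation of \<open>u \<mapsto> \<integral> L (u \<phi>) (u' \<phi>) \<phi> d\<phi>\<close>, with Lagrangian \<open>L v p \<phi>\<close>.
\<close>

definition euler_lagrange :: "(real \<Rightarrow> real \<Rightarrow> real \<Rightarrow> real) \<Rightarrow> (real \<Rightarrow> real) \<Rightarrow> bool" where
  "euler_lagrange L u \<longleftrightarrow>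
     (\<forall>\<phi>. ((\<lambda>t. deriv (\<lambda>p. L (u t) p t) (deriv u t))
             has_real_derivative deriv (\<lambda>v. L v (deriv u \<phi>) \<phi>) (u \<phi>)) (at \<phi>))"

text \<open>Only used for \<open>z \<ge> 0\<close>, where the solution exists and is unique.\<close>

definition lambert_W :: "real \<Rightarrow> real" where
  "lambert_W z = (THE w. 0 \<le> w \<and> z = w * exp w)"

definition hamiltonian :: "(real \<Rightarrow> real) \<Rightarrow> real \<Rightarrow> real \<Rightarrow> real" where
  "hamiltonian f I \<phi> = I\<^sup>2 / 2 + f \<phi>"

definition gamma_k :: "(real \<Rightarrow> real) \<Rightarrow> nat \<Rightarrow> real \<Rightarrow> real \<Rightarrow> real" where
  "gamma_k f k c \<phi> = sqrt (lambert_W (exp (2 * (c - f \<phi>) * real k) * real k) / real k)"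

definition gamma_0 :: "(real \<Rightarrow> real) \<Rightarrow> real \<Rightarrow> real \<Rightarrow> real" where
  "gamma_0 f c \<phi> = (if c > f \<phi> then sqrt (2 * (c - f \<phi>)) else 0)"

definition c_k :: "(real \<Rightarrow> real) \<Rightarrow> nat \<Rightarrow> real \<Rightarrow> real" where
  "c_k f k I = (THE c. I = 1 / (2 * pi) * integral {0..2 * pi} (gamma_k f k c))"

definition c_0 :: "(real \<Rightarrow> real) \<Rightarrow> real \<Rightarrow> real" where
  "c_0 f I = (THE c. I = 1 / (2 * pi) * integral {0..2 * pi} (gamma_0 f c))"

text \<open>
  The common shape of \<open>u\<^sub>k\<close> and \<open>u\<^sub>0\<close>. The formula is evaluated at the representative
  \<open>\<phi> rmod (2 * pi)\<close> of \<open>\<phi>\<close> in \<open>[0, 2\<pi>)\<close>, which makes it a function on the circle.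
\<close>

definition circle_primitive :: "(real \<Rightarrow> real) \<Rightarrow> real \<Rightarrow> real \<Rightarrow> real" where
  "circle_primitive g I \<phi> =
     (let t = \<phi> rmod (2 * pi) in
        I * (pi - t)
        - 1 / (2 * pi) * integral {0..2 * pi} (\<lambda>y. integral {0..y} g)
        + integral {0..t} g)"

definition u_k :: "(real \<Rightarrow> real) \<Rightarrow> nat \<Rightarrow> real \<Rightarrow> real \<Rightarrow> real" where
  "u_k f k I = circle_primitive (gamma_k f k (c_k f k I)) I"

definition u_0 :: "(real \<Rightarrow> real) \<Rightarrow> real \<Rightarrow> real \<Rightarrow> real" where
  "u_0 f I = circle_primitive (gamma_0 f (c_0 f I)) I"

definition sigma_k :: "(real \<Rightarrow> real) \<Rightarrow> nat \<Rightarrow> real \<Rightarrow> real \<Rightarrow> real" where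
  "sigma_k f k I \<phi> =
     (1 / gamma_k f k (c_k f k I) \<phi>)
     / integral {0..2 * pi} (\<lambda>x. 1 / gamma_k f k (c_k f k I) x)"

definition Hbar_k :: "(real \<Rightarrow> real) \<Rightarrow> nat \<Rightarrow> real \<Rightarrow> real" where
  "Hbar_k f k I =
     c_k f k I
     + 1 / real k * ln (integral {0..2 * pi} (\<lambda>\<phi>. 1 / gamma_k f k (c_k f k I) \<phi>))"

definition Hbar :: "(real \<Rightarrow> real) \<Rightarrow> real \<Rightarrow> real" where
  "Hbar f I = (if c_0 f I > (SUP \<phi>. f \<phi>) then c_0 f I else (SUP \<phi>. f \<phi>))"

end

theory Submission
  imports Defs
begin

text \<open>
  The defining equation of \<open>W\<close> says that \<open>\<gamma>\<^sub>k\<close> solves \<open>\<gamma>\<^sup>2 / 2 + ln \<gamma> / k = c - f\<close>, so \<open>\<gamma>\<^sub>k\<close> is a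
  smooth increasing function of \<open>c - f\<close> alone. Inserting \<open>\<gamma>\<^sub>0 \<plusminus> \<epsilon>\<close> into the left-hand side gives
  \<open>\<bar>\<gamma>\<^sub>k - \<gamma>\<^sub>0\<bar> \<le> \<epsilon>\<close> everywhere for large \<open>k\<close>; strict monotonicity of the mean of \<open>\<gamma>\<^sub>0\<close> in \<open>c\<close> turns this
  into \<open>c\<^sub>k \<longlonglongrightarrow> c\<close>. The equation also reads \<open>1 / \<gamma>\<^sub>k = exp (k (H - c\<^sub>k))\<close>, which makes the momentum
  flux constant, and presents \<open>Hbar\<^sub>k\<close> as \<open>1 / k\<close> times the logarithm of \<open>\<integral> exp (k H)\<close>, where
  \<open>H \<longlonglongrightarrow> max c f\<close> uniformly.
\<close>

subsection \<open>Calculus of functions of class \<open>C\<^sup>m\<close>\<close>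

text \<open>Derivatives are unique, so \<open>frechet_derivative\<close> may be replaced by any
  explicit formula for the derivative. The proofs by induction on \<open>m\<close> below work with
  such formulas.\<close>

lemma C_diff_SucI:
  assumes "\<And>x. (g has_derivative g' x) (at x)"
    and "\<And>v. C_diff m (\<lambda>x. g' x v)"
  shows "C_diff (Suc m) g"
proof -
  have "frechet_derivative g (at x) = g' x" for x
    using frechet_derivative_at[OF assms(1)] by simp
  then show ?thesis
    using assms by (auto simp: differentiable_def)
qed

lemma C_diff_SucE:
  assumes "C_diff (Suc m) g"
  obtains g' where "\<And>x. (g has_derivative g' x) (at x)" "\<And>v. C_diff m (\<lambda>x. g' x v)"
  using assms frechet_derivative_works
  by (metis C_diff.simps(2))

lemma C_diff_continuous:
  assumes "C_diff m g"
  shows "continuous_on UNIV g"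
proof (cases m)
  case 0
  then show ?thesis using assms by simp
next
  case (Suc n)
  then show ?thesis
    using assms by (auto intro!: differentiable_imp_continuous_on simp: differentiable_on_def
      differentiable_at_withinI)
qed

lemma C_diff_Suc_imp: "C_diff (Suc m) g \<Longrightarrow> C_diff m g"
proof (induction m arbitrary: g)
  case 0
  then show ?case using C_diff_continuous by (metis C_diff.simps(1))
next
  case (Suc m)
  then show ?case by (metis C_diff.simps(2))
qed

lemma C_diff_const: "C_diff m (\<lambda>x. c)"
proof (induction m arbitrary: c)
  case (Suc m)
  then show ?case
    by (intro C_diff_SucI[where g' = "\<lambda>x v. 0"]) auto
qed (simp add: continuous_on_const)

lemma C_diff_bounded_linear:
  assumes "bounded_linear g"
  shows "C_diff m g"
proof (cases m)
  case 0
  then show ?thesis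
    using assms by (simp add: linear_continuous_on)
next
  case (Suc n)
  have "C_diff (Suc n) g"
    by (rule C_diff_SucI[where g' = "\<lambda>x. g"])
       (auto intro: bounded_linear_imp_has_derivative assms C_diff_const)
  then show ?thesis using Suc by simp
qed

lemma C_diff_add: "C_diff m g \<Longrightarrow> C_diff m h \<Longrightarrow> C_diff m (\<lambda>x. g x + h x)"
proof (induction m arbitrary: g h)
  case 0
  then show ?case by (simp add: continuous_on_add)
next
  case (Suc m)
  obtain g' where g': "\<And>x. (g has_derivative g' x) (at x)" "\<And>v. C_diff m (\<lambda>x. g' x v)"
    using Suc.prems(1) C_diff_SucE by blast
  obtain h' where h': "\<And>x. (h has_derivative h' x) (at x)" "\<And>v. C_diff m (\<lambda>x. h' x v)"
    using Suc.prems(2) C_diff_SucE by blast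
  show ?case
    by (rule C_diff_SucI[where g' = "\<lambda>x v. g' x v + h' x v"])
       (auto intro!: has_derivative_add g' h' Suc.IH)
qed

text \<open>The product rule leaves undifferentiated factors, which are only needed at order
  \<open>m\<close>; \<open>C_diff_Suc_imp\<close> supplies this. The factors change in the
  induction, hence both are arbitrary.\<close>

lemma C_diff_mult:
  fixes g h :: "'a::real_normed_vector \<Rightarrow> real"
  shows "C_diff m g \<Longrightarrow> C_diff m h \<Longrightarrow> C_diff m (\<lambda>x. g x * h x)"
proof (induction m arbitrary: g h)
  case 0
  then show ?case by (simp add: continuous_on_mult)
next
  case (Suc m)
  obtain g' where g': "\<And>x. (g has_derivative g' x) (at x)" "\<And>v. C_diff m (\<lambda>x. g' x v)"
    using Suc.prems(1) C_diff_SucE by blast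
  obtain h' where h': "\<And>x. (h has_derivative h' x) (at x)" "\<And>v. C_diff m (\<lambda>x. h' x v)"
    using Suc.prems(2) C_diff_SucE by blast
  show ?case
    by (rule C_diff_SucI[where g' = "\<lambda>x v. g x * h' x v + g' x v * h x"])
       (intro has_derivative_mult g' h' C_diff_add Suc.IH Suc.prems[THEN C_diff_Suc_imp])+
qed

lemma C_diff_diff:
  fixes g h :: "'a::real_normed_vector \<Rightarrow> real"
  assumes "C_diff m g" "C_diff m h"
  shows "C_diff m (\<lambda>x. g x - h x)"
  using C_diff_add[OF assms(1) C_diff_mult[OF C_diff_const[of m "-1"] assms(2)]] by simp

text \<open>The derivative of 1/g is built from g' and 1/g itself, so the induction hypothesis is
  applied to the same g.\<close>

lemma C_diff_inverse:
  fixes g :: "'a::real_normed_vector \<Rightarrow> real"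
  assumes "\<And>x. g x \<noteq> 0"
  shows "C_diff m g \<Longrightarrow> C_diff m (\<lambda>x. inverse (g x))"
proof (induction m)
  case 0
  then show ?case using assms by (simp add: continuous_on_inverse)
next
  case (Suc m)
  obtain g' where g': "\<And>x. (g has_derivative g' x) (at x)" "\<And>v. C_diff m (\<lambda>x. g' x v)"
    using Suc.prems(1) C_diff_SucE by blast
  have inv: "C_diff m (\<lambda>x. inverse (g x))"
    by (intro Suc.IH Suc.prems[THEN C_diff_Suc_imp])
  show ?case
  proof (rule C_diff_SucI)
    show "((\<lambda>x. inverse (g x)) has_derivative (\<lambda>v. - (inverse (g x) * g' x v * inverse (g x)))) (at x)" for x
      by (intro Deriv.has_derivative_inverse g' assms)
    show "C_diff m (\<lambda>x. - (inverse (g x) * g' x v * inverse (g x)))" for v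
      using C_diff_diff[OF C_diff_const[of m 0] C_diff_mult[OF C_diff_mult[OF inv g'(2)[of v]] inv]]
      by simp
  qed
qed

lemma C_diff_compose_snd:
  "C_diff m g \<Longrightarrow> C_diff m (\<lambda>p :: 'a::real_normed_vector \<times> 'b::real_normed_vector. g (snd p))"
proof (induction m arbitrary: g)
  case 0
  then show ?case
    using continuous_on_compose2[of UNIV g UNIV snd] by (simp add: continuous_on_snd)
next
  case (Suc m)
  obtain g' where g': "\<And>x. (g has_derivative g' x) (at x)" "\<And>v. C_diff m (\<lambda>x. g' x v)"
    using Suc.prems(1) C_diff_SucE by blast
  show ?case
  proof (rule C_diff_SucI)
    show "((\<lambda>p. g (snd p)) has_derivative (\<lambda>v. g' (snd p) (snd v))) (at p)" 
      for p :: "'a \<times> 'b"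
      by (rule has_derivative_compose[OF has_derivative_snd[OF has_derivative_ident] g'(1)])
  qed (intro Suc.IH g')
qed

lemma C_diff_Suc_real:
  fixes g :: "real \<Rightarrow> real"
  assumes "\<And>x. (g has_real_derivative g' x) (at x)" "C_diff m g'"
  shows "C_diff (Suc m) g"
proof (rule C_diff_SucI)
  show "(g has_derivative (\<lambda>v. g' x * v)) (at x)" for x
    using assms(1) by (simp add: has_field_derivative_def)
qed (intro C_diff_mult assms C_diff_const)

subsection \<open>The momentum as a function of \<open>c - f \<phi>\<close>\<close>

definition momentum :: "nat \<Rightarrow> real \<Rightarrow> real" where
  "momentum k s = sqrt (lambert_W (exp (2 * s * real k) * real k) / real k)"

text \<open>The truncation replaces the case distinction of \<open>gamma_0\<close>, so that
  continuity is immediate.\<close>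

definition momentum_0 :: "real \<Rightarrow> real" where
  "momentum_0 s = sqrt (2 * max s 0)"

text \<open>The function inverted by \<open>momentum k\<close>; it turns the defining equation of \<open>W\<close> into
  \<open>\<gamma>\<^sub>k\<^sup>2 / 2 + f + ln \<gamma>\<^sub>k / k = c\<close>.\<close>

definition energy :: "nat \<Rightarrow> real \<Rightarrow> real" where
  "energy k x = x\<^sup>2 / 2 + ln x / real k"

lemma gamma_k_eq: "gamma_k f k c \<phi> = momentum k (c - f \<phi>)"
  by (simp add: gamma_k_def momentum_def)

lemma gamma_0_eq: "gamma_0 f c \<phi> = momentum_0 (c - f \<phi>)"
  by (simp add: gamma_0_def momentum_0_def)

text \<open>The description in \<open>lambert_W\<close> is justified by the intermediate value
  theorem on [0, z], where z <= z exp z, and by strict monotonicity of w exp w for w >= 0.\<close>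

lemma lambert_W:
  assumes "0 \<le> z"
  shows "0 \<le> lambert_W z \<and> z = lambert_W z * exp (lambert_W z)"
proof -
  have "\<exists>w\<ge>0. w \<le> z \<and> w * exp w = z"
  proof (rule IVT')
    show "z \<le> z * exp z"
      using assms mult_left_mono[of 1 "exp z" z] by simp
  qed (auto intro!: continuous_intros simp: assms)
  then obtain w where w: "0 \<le> w" "z = w * exp w" by blast
  have "w' = w" if "0 \<le> w'" "z = w' * exp w'" for w'
  proof -
    have mono: "a * exp a < b * exp b" if "0 \<le> a" "a < b" for a b :: real
      using that by (intro mult_strict_mono) auto
    show ?thesis using mono[of w w'] mono[of w' w] w that by linarith
  qed
  then have "lambert_W z = w"
    unfolding lambert_W_def using w by blast
  then show ?thesis using w by simp
qed

lemma energy_strict_mono: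
  assumes "0 < x" "x < y" shows "energy k x < energy k y"
proof -
  have "x\<^sup>2 < y\<^sup>2" using assms by (simp add: power_strict_mono)
  moreover have "ln x / real k \<le> ln y / real k"
    using assms by (intro divide_right_mono) auto
  ultimately show ?thesis by (simp add: energy_def)
qed

text \<open>With w the value of \<open>lambert_W\<close> at z = k exp (2 s k), the logarithm of z =
  w exp w reads w + ln w - ln k = 2 s k. Since the squared momentum is w / k, division by 2 k gives
  the energy.\<close>

lemma
  assumes "k \<ge> 1"
  shows momentum_pos: "0 < momentum k s"
    and energy_momentum: "energy k (momentum k s) = s"
proof -
  define z where "z = exp (2 * s * real k) * real k"
  define w where "w = lambert_W z"
  have z: "0 < z" using assms by (simp add: z_def)
  have w: "0 \<le> w" "z = w * exp w" using lambert_W[of z] z by (auto simp: w_def)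
  then have "0 < w" using z by (cases "w = 0") auto
  show pos: "0 < momentum k s"
    using \<open>0 < w\<close> assms by (simp add: momentum_def flip: z_def w_def)
  have "ln z = ln w + w" using w \<open>0 < w\<close> by (simp add: ln_mult)
  moreover have "ln z = 2 * s * real k + ln (real k)" using assms by (simp add: z_def ln_mult)
  ultimately have eq: "w + ln w - ln (real k) = 2 * s * real k" by simp
  have "(momentum k s)\<^sup>2 = w / real k"
    using \<open>0 < w\<close> by (simp add: momentum_def flip: z_def w_def)
  moreover have "ln (momentum k s) = (ln w - ln (real k)) / 2"
    using \<open>0 < w\<close> assms by (simp add: momentum_def ln_sqrt ln_div flip: z_def w_def)
  ultimately have "energy k (momentum k s) = (w + ln w - ln (real k)) / (2 * real k)"
    by (simp add: energy_def add_divide_distrib diff_divide_distrib)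
  then show "energy k (momentum k s) = s"
    using assms by (simp add: eq)
qed

text \<open>Bounds on the implicitly defined momentum become inequalities for the explicit function
  \<open>energy\<close>, so no asymptotics of W are needed.\<close>

lemma momentum_le_iff:
  assumes "k \<ge> 1" "0 < x"
  shows "momentum k s \<le> x \<longleftrightarrow> s \<le> energy k x"
  using energy_strict_mono[of "momentum k s" x k] energy_strict_mono[of x "momentum k s" k]
    momentum_pos[of k s] energy_momentum[of k s] assms
  by (cases "momentum k s" x rule: linorder_cases) auto

lemma le_momentum_iff:
  assumes "k \<ge> 1" "0 < x"
  shows "x \<le> momentum k s \<longleftrightarrow> energy k x \<le> s"
  using energy_strict_mono[of "momentum k s" x k] energy_strict_mono[of x "momentum k s" k]
    momentum_pos[of k s] energy_momentum[of k s] assms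
  by (cases "momentum k s" x rule: linorder_cases) auto

lemma momentum_energy: "k \<ge> 1 \<Longrightarrow> 0 < x \<Longrightarrow> momentum k (energy k x) = x"
  by (simp add: order_antisym momentum_le_iff le_momentum_iff)

lemma momentum_strict_mono:
  assumes "k \<ge> 1" "s < t" shows "momentum k s < momentum k t"
  using le_momentum_iff[of k "momentum k t" s] momentum_pos[of k t] energy_momentum[of k t] assms
  by (simp flip: not_le)

text \<open>A monotone function with open range has no jumps.\<close>

lemma continuous_on_momentum:
  assumes "k \<ge> 1" shows "continuous_on UNIV (momentum k)"
proof (rule continuous_onI_mono)
  have "range (momentum k) = {0<..}"
    using assms momentum_pos momentum_energy by (auto simp: image_iff) (metis)
  then show "open (range (momentum k))" by simp
  show "momentum k s \<le> momentum k t" if "s \<le> t" for s t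
    using momentum_strict_mono[OF assms, of s t] that by (cases "s = t") auto
qed

text \<open>By the inverse function rule the derivative is 1 / (x + 1 / (k x)) with x the momentum.
  It is rewritten so that the inverted denominator is at least 1 and is polynomial in x.\<close>

lemma momentum_has_derivative:
  assumes "k \<ge> 1"
  shows "(momentum k has_real_derivative
    real k * momentum k s * inverse (1 + real k * (momentum k s * momentum k s))) (at s)"
proof -
  define x where "x = momentum k s"
  have x: "0 < x" using momentum_pos assms by (simp add: x_def)
  have "(energy k has_real_derivative x + 1 / x / real k) (at x)"
    unfolding energy_def using x assms by (auto intro!: derivative_eq_intros)
  then have "DERIV (momentum k) s :> inverse (x + 1 / x / real k)"
  proof (rule DERIV_inverse_function[where f = "energy k" and g = "momentum k" and x = s
        and a = "s - 1" and b = "s + 1", folded x_def])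
    show "isCont (momentum k) s"
      using continuous_on_momentum[OF assms] by (simp add: continuous_on_eq_continuous_at)
  qed (use x assms in \<open>auto simp: x_def energy_momentum add_pos_pos less_imp_neq[symmetric]\<close>)
  moreover have "inverse (x + 1 / x / real k) = real k * x * inverse (1 + real k * (x * x))"
  proof -
    have "x * x * real k + 1 > 0" using x by (simp add: add_nonneg_pos)
    then show ?thesis using x assms by (simp add: field_simps)
  qed
  ultimately show ?thesis by (simp add: x_def)
qed

text \<open>The derivative of \<open>momentum k\<close> is a rational expression in
  \<open>momentum k\<close> itself, so regularity of order \<open>m\<close> of the composite yields
  order \<open>Suc m\<close>.\<close>

lemma C_diff_momentum_compose:
  fixes h :: "'a::real_normed_vector \<Rightarrow> real"
  assumes "k \<ge> 1"
  shows "C_diff m h \<Longrightarrow> C_diff m (\<lambda>x. momentum k (h x))"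
proof (induction m)
  case 0
  then show ?case
    using continuous_on_compose2[OF continuous_on_momentum[OF assms]] by auto
next
  case (Suc m)
  obtain h' where h': "\<And>x. (h has_derivative h' x) (at x)" "\<And>v. C_diff m (\<lambda>x. h' x v)"
    using Suc.prems(1) C_diff_SucE by blast
  define D where "D = (\<lambda>x. real k * momentum k (h x) *
    inverse (1 + real k * (momentum k (h x) * momentum k (h x))))"
  have ih: "C_diff m (\<lambda>x. momentum k (h x))"
    by (intro Suc.IH Suc.prems[THEN C_diff_Suc_imp])
  have "1 + real k * (y * y) \<noteq> 0" for y :: real
    using mult_nonneg_nonneg[of "real k" "y * y"] by (smt (verit) zero_le_square of_nat_0_le_iff)
  then have D: "C_diff m D"
    unfolding D_def by (intro C_diff_mult C_diff_inverse C_diff_add C_diff_const ih)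
  show ?case
  proof (rule C_diff_SucI)
    show "((\<lambda>x. momentum k (h x)) has_derivative (\<lambda>v. D x * h' x v)) (at x)" for x
      using has_derivative_compose[OF h'(1) momentum_has_derivative[OF assms, 
        unfolded has_field_derivative_def]]
      by (simp add: D_def)
  qed (intro C_diff_mult D h')
qed

section \<open>The limiting momentum and uniform convergence to it\<close>

lemma momentum_0_nonneg: "0 \<le> momentum_0 s"
  by (simp add: momentum_0_def)

lemma momentum_0_square: "(momentum_0 s)\<^sup>2 / 2 = max s 0"
  by (simp add: momentum_0_def)

lemma momentum_0_mono: "s \<le> t \<Longrightarrow> momentum_0 s \<le> momentum_0 t"
  by (auto simp: momentum_0_def)

lemma momentum_0_strict_mono: "s < t \<Longrightarrow> 0 < t \<Longrightarrow> momentum_0 s < momentum_0 t"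
  by (auto simp: momentum_0_def)

lemma momentum_0_half_square: "0 \<le> x \<Longrightarrow> momentum_0 (x\<^sup>2 / 2) = x"
  by (simp add: momentum_0_def)

lemma continuous_on_momentum_0: "continuous_on UNIV momentum_0"
  unfolding momentum_0_def by (intro continuous_intros)

text \<open>Hoelder continuity of exponent 1/2, uniform in s and t; it later absorbs the replacement
  of \<open>c_k\<close> by \<open>c_0\<close>.\<close>

lemma momentum_0_diff_le: "\<bar>momentum_0 s - momentum_0 t\<bar> \<le> sqrt (2 * \<bar>s - t\<bar>)"
proof -
  have "momentum_0 b - momentum_0 a \<le> sqrt (2 * (b - a))" if "a \<le> b" for a b
  proof -
    have "momentum_0 b \<le> sqrt (2 * max a 0 + 2 * (b - a))"
      unfolding momentum_0_def using that by simp
    also have "\<dots> \<le> momentum_0 a + sqrt (2 * (b - a))"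
      unfolding momentum_0_def using that by (intro sqrt_add_le_add_sqrt) auto
    finally show ?thesis by simp
  qed
  from this[of s t] this[of t s] momentum_0_mono[of s t] momentum_0_mono[of t s]
  show ?thesis by (cases "s \<le> t") (auto simp: abs_if)
qed

text \<open>The energies of x + e and x - e, with x = \<open>momentum_0 s\<close>, are compared with
  s. The first threshold on k controls ln near 0, the second controls its growth; neither depends on
  s, which is what makes the convergence uniform.\<close>

lemma momentum_near_momentum_0:
  assumes k: "k \<ge> 1" and e: "0 < e" "- 2 * ln e / e\<^sup>2 \<le> real k" "2 / e \<le> real k"
  shows "\<bar>momentum k s - momentum_0 s\<bar> \<le> e"
proof -
  define x where "x = momentum_0 s"
  have x: "0 \<le> x" "s \<le> x\<^sup>2 / 2"
    by (simp_all add: x_def momentum_0_nonneg momentum_0_square)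
  have "momentum k s \<le> x + e"
  proof -
    have "- ln e / real k \<le> e\<^sup>2 / 2"
      using e k by (simp add: field_simps)
    moreover have "ln e / real k \<le> ln (x + e) / real k"
      using x e by (intro divide_right_mono) auto
    moreover have "x\<^sup>2 / 2 + e\<^sup>2 / 2 \<le> (x + e)\<^sup>2 / 2"
      using x e by (simp add: power2_sum)
    ultimately have "s \<le> energy k (x + e)" using x by (simp add: energy_def)
    then show ?thesis using momentum_le_iff k x e by auto
  qed
  moreover have "x - e \<le> momentum k s"
  proof (cases "x \<le> e")
    case True
    then show ?thesis using momentum_pos[OF k, of s] by simp
  next
    case False
    \<comment> \<open>Here x > e > 0, so the truncation is inactive and s = x^2 / 2 exactly.\<close>
    then have "s > 0" using e by (cases "s > 0") (auto simp: x_def momentum_0_def)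
    then have s: "s = x\<^sup>2 / 2" by (simp add: x_def momentum_0_square)
    \<comment> \<open>The logarithmic term may grow with x, but only linearly; the cross term - e x
      of (x - e)^2 / 2 outweighs it once 1 / k <= e / 2.\<close>
    have "ln (x - e) / real k \<le> x / real k"
      using ln_le_minus_one[of "x - e"] False e by (intro divide_right_mono) auto
    also have "\<dots> \<le> e * x / 2"
    proof -
      have "1 / real k \<le> e / 2" using e k by (simp add: field_simps)
      then show ?thesis using mult_right_mono[of "1 / real k" "e / 2" x] x by simp
    qed
    finally have "energy k (x - e) \<le> (x - e)\<^sup>2 / 2 + e * x / 2" by (simp add: energy_def)
    also have "\<dots> = s - e * (x - e) / 2"
      by (simp add: s power2_eq_square algebra_simps) (simp add: field_simps)
    also have "\<dots> \<le> s" using False e by simp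
    finally show ?thesis using le_momentum_iff k False by simp
  qed
  ultimately show ?thesis by (simp add: x_def abs_le_iff)
qed

lemma momentum_uniform_limit: "uniform_limit UNIV momentum momentum_0 sequentially"
proof (rule uniform_limitI)
  fix e :: real assume e: "0 < e"
  define d where "d = e / 2"
  have d: "0 < d" using e by (simp add: d_def)
  have "\<forall>\<^sub>F k in sequentially. b \<le> real k" for b
    using filterlim_real_sequentially by (simp add: filterlim_at_top)
  then have "\<forall>\<^sub>F k in sequentially. 1 \<le> real k \<and> - 2 * ln d / d\<^sup>2 \<le> real k \<and> 2 / d \<le> real k"
    by (intro eventually_conj)
  then show "\<forall>\<^sub>F k in sequentially. \<forall>s\<in>UNIV. dist (momentum k s) (momentum_0 s) < e"
  proof eventually_elim
    case (elim k)
    then have "\<bar>momentum k s - momentum_0 s\<bar> \<le> d" for s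
      using momentum_near_momentum_0[of k d s] d by simp
    moreover have "d < e" using e by (simp add: d_def)
    ultimately show ?case by (metis dist_real_def le_less_trans)
  qed
qed

subsection \<open>Periodic functions\<close>

lemma periodic_rmod:
  assumes "periodic_fun_simple f (2 * pi)"
  shows "f (x rmod (2 * pi)) = f x"
proof -
  interpret periodic_fun_simple f "2 * pi" by fact
  show ?thesis
    using minus_of_int[of x "\<lfloor>x / (2 * pi)\<rfloor>"] by (simp add: rmod_def mult.commute)
qed

lemma rmod_mem: "x rmod (2 * pi) \<in> {0..2 * pi}"
  by (simp add: rmod_nonneg rmod_le)

text \<open>\<open>circle_primitive\<close> is defined through representatives, so differentiability
  at multiples of 2 pi is not visible. An antiderivative P of p - I on the whole line is periodic
  because p has mean I, and then \<open>circle_primitive\<close> equals P up to a constant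
  everywhere.\<close>

lemma circle_primitive_antiderivative:
  assumes cont: "continuous_on UNIV p" and per: "periodic_fun_simple p (2 * pi)"
    and int: "integral {0..2 * pi} p = 2 * pi * I"
  obtains P d where "\<And>x. (P has_real_derivative p x - I) (at x)"
    "circle_primitive p I = (\<lambda>x. P x + d)"
    "\<And>t. 0 \<le> t \<Longrightarrow> integral {0..t} p = P t - P 0 + I * t"
    "P (2 * pi) = P 0"
proof -
  interpret p: periodic_fun_simple p "2 * pi" by fact
  have "\<exists>P. \<forall>x::real. -\<infinity> < ereal x \<longrightarrow> ereal x < \<infinity> \<longrightarrow> (P has_vector_derivative p x - I) (at x)"
    using cont by (intro einterval_antiderivative)
      (auto intro!: continuous_intros simp: continuous_on_eq_continuous_at)
  then obtain P where P: "\<And>x. (P has_real_derivative p x - I) (at x)"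
    by (auto simp: has_real_derivative_iff_has_vector_derivative)
  have int_p: "integral {0..t} p = P t - P 0 + I * t" if "0 \<le> t" for t
  proof -
    have "((\<lambda>x. P x + I * x) has_vector_derivative p x) (at x within {0..t})" for x
      using DERIV_add[OF P[of x] DERIV_cmult_Id[of I x]]
      by (simp add: has_real_derivative_iff_has_vector_derivative has_vector_derivative_at_within)
    from fundamental_theorem_of_calculus[OF that this] show ?thesis
      by (simp add: integral_unique)
  qed
  \<comment> \<open>The increment over one period has derivative p (x + 2 pi) - p x = 0.\<close>
  have shift: "P (x + 2 * pi) - P x = P (0 + 2 * pi) - P 0" for x
  proof (rule DERIV_isconst_all[where f = "\<lambda>x. P (x + 2 * pi) - P x"], intro allI)
    show "((\<lambda>x. P (x + 2 * pi) - P x) has_real_derivative 0) (at x)" for x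
      using DERIV_diff[OF iffD1[OF DERIV_shift P[of "x + 2 * pi"]] P[of x]]
      by (simp add: p.plus_period)
  qed
  have P0: "P (2 * pi) = P 0" using int_p[of "2 * pi"] int by simp
  interpret P: periodic_fun_simple P "2 * pi"
    by standard (use shift P0 in simp)
  have Prmod: "P (x rmod (2 * pi)) = P x" for x
    by (intro periodic_rmod) unfold_locales
  have "circle_primitive p I = (\<lambda>x. P x +
      (I * pi - P 0 - 1 / (2 * pi) * integral {0..2 * pi} (\<lambda>y. integral {0..y} p)))"
  proof
    fix x
    have "0 \<le> x rmod (2 * pi)" by (simp add: rmod_nonneg)
    from int_p[OF this] show "circle_primitive p I x = P x +
      (I * pi - P 0 - 1 / (2 * pi) * integral {0..2 * pi} (\<lambda>y. integral {0..y} p))"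
      unfolding circle_primitive_def Let_def Prmod by (simp add: algebra_simps)
  qed
  then show ?thesis using that P int_p P0 by blast
qed

lemma circle_primitive_has_derivative:
  assumes "continuous_on UNIV p" "periodic_fun_simple p (2 * pi)"
    and "integral {0..2 * pi} p = 2 * pi * I"
  shows "(circle_primitive p I has_real_derivative p x - I) (at x)"
proof -
  obtain P d where P: "\<And>x. (P has_real_derivative p x - I) (at x)"
    "circle_primitive p I = (\<lambda>x. P x + d)"
    by (rule circle_primitive_antiderivative[OF assms]) (rule that)
  show ?thesis
    unfolding P(2) using DERIV_add[OF P(1) DERIV_const[of d]] by simp
qed

lemma integral_circle_primitive:
  assumes "continuous_on UNIV p" "periodic_fun_simple p (2 * pi)"
    and "integral {0..2 * pi} p = 2 * pi * I"
  shows "integral {0..2 * pi} (circle_primitive p I) = 0"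
proof -
  obtain P d where P: "\<And>x. (P has_real_derivative p x - I) (at x)"
    "circle_primitive p I = (\<lambda>x. P x + d)"
    "\<And>t. 0 \<le> t \<Longrightarrow> integral {0..t} p = P t - P 0 + I * t" "P (2 * pi) = P 0"
    by (rule circle_primitive_antiderivative[OF assms]) (rule that)
  define C where "C = integral {0..2 * pi} (\<lambda>y. integral {0..y} p)"
  \<comment> \<open>Unfolding the definition would send x = 2 pi to the representative 0. Passing
    through P + d covers this endpoint too, and the value at 0 determines d.\<close>
  have eq: "circle_primitive p I x = I * (pi - x) - 1 / (2 * pi) * C + integral {0..x} p"
    if "x \<in> {0..2 * pi}" for x
  proof -
    have "circle_primitive p I 0 = I * pi - 1 / (2 * pi) * C"
      by (simp add: circle_primitive_def C_def)
    then show ?thesis using P(2) P(3)[of x] that by (simp add: algebra_simps)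
  qed
  have "continuous_on {0..2 * pi} p"
    using assms(1) by (rule continuous_on_subset) simp
  then have "((\<lambda>y. integral {0..y} p) has_integral C) {0..2 * pi}"
    unfolding C_def
    by (intro integrable_integral integrable_continuous_interval indefinite_integral_continuous_1)
  moreover have "((\<lambda>x. I * (pi - x) - 1 / (2 * pi) * C) has_integral
      (I * (pi * (2 * pi) - (2 * pi)\<^sup>2 / 2) - 1 / (2 * pi) * C * (2 * pi)) -
      (I * (pi * 0 - 0\<^sup>2 / 2) - 1 / (2 * pi) * C * 0)) {0..2 * pi}"
    by (rule fundamental_theorem_of_calculus)
       (auto simp flip: has_real_derivative_iff_has_vector_derivative intro!: derivative_eq_intros)
  ultimately have "((\<lambda>x. I * (pi - x) - 1 / (2 * pi) * C + integral {0..x} p) has_integral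
      ((I * (pi * (2 * pi) - (2 * pi)\<^sup>2 / 2) - 1 / (2 * pi) * C * (2 * pi)) -
      (I * (pi * 0 - 0\<^sup>2 / 2) - 1 / (2 * pi) * C * 0)) + C) {0..2 * pi}"
    by (rule has_integral_add[rotated])
  then have "(circle_primitive p I has_integral
      ((I * (pi * (2 * pi) - (2 * pi)\<^sup>2 / 2) - 1 / (2 * pi) * C * (2 * pi)) -
      (I * (pi * 0 - 0\<^sup>2 / 2) - 1 / (2 * pi) * C * 0)) + C) {0..2 * pi}"
    by (rule has_integral_eq[rotated]) (simp add: eq)
  then show ?thesis by (simp add: integral_unique power2_eq_square)
qed

lemma integral_diff_le:
  fixes p q :: "real \<Rightarrow> real"
  assumes "continuous_on {0..t} p" "continuous_on {0..t} q" "0 \<le> t"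
    and "\<And>x. x \<in> {0..t} \<Longrightarrow> \<bar>p x - q x\<bar> \<le> d"
  shows "\<bar>integral {0..t} p - integral {0..t} q\<bar> \<le> d * t"
proof -
  have "integral {0..t} p - integral {0..t} q = integral {0..t} (\<lambda>x. p x - q x)"
    using assms by (intro Henstock_Kurzweil_Integration.integral_diff[symmetric]
        integrable_continuous_interval)
  moreover have "norm (integral {0..t} (\<lambda>x. p x - q x)) \<le> d * (t - 0)"
    using assms by (intro integral_bound continuous_on_diff) auto
  ultimately show ?thesis by simp
qed

text \<open>The single integral contributes at most 2 pi d, and so does the averaged double
  integral: (2 pi)^2 d divided by 2 pi.\<close>

lemma circle_primitive_diff_le:
  assumes "continuous_on UNIV p" "continuous_on UNIV q"
    and d: "\<And>x. \<bar>p x - q x\<bar> \<le> d"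
  shows "\<bar>circle_primitive p I x - circle_primitive q I x\<bar> \<le> 4 * pi * d"
proof -
  have "0 \<le> d" using d[of 0] by linarith
  have cont: "continuous_on A p" "continuous_on A q" for A
    using assms by (auto intro: continuous_on_subset)
  have int: "\<bar>integral {0..t} p - integral {0..t} q\<bar> \<le> d * (2 * pi)" if "t \<in> {0..2 * pi}" for t
  proof -
    have "\<bar>integral {0..t} p - integral {0..t} q\<bar> \<le> d * t"
      using that by (intro integral_diff_le cont d) auto
    also have "\<dots> \<le> d * (2 * pi)"
      using that \<open>0 \<le> d\<close> by (intro mult_left_mono) auto
    finally show ?thesis .
  qed
  have "\<bar>integral {0..2 * pi} (\<lambda>y. integral {0..y} p) - integral {0..2 * pi} (\<lambda>y. integral {0..y} q)\<bar>
      \<le> d * (2 * pi) * (2 * pi)"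
    by (intro integral_diff_le indefinite_integral_continuous_1 integrable_continuous_interval cont int)
       auto
  then have "\<bar>1 / (2 * pi) * integral {0..2 * pi} (\<lambda>y. integral {0..y} p) -
      1 / (2 * pi) * integral {0..2 * pi} (\<lambda>y. integral {0..y} q)\<bar> \<le> d * (2 * pi)"
    by (simp add: abs_le_iff field_simps)
  moreover have "\<bar>integral {0..x rmod (2 * pi)} p - integral {0..x rmod (2 * pi)} q\<bar> \<le> d * (2 * pi)"
    using int rmod_mem by blast
  moreover have "4 * pi * d = d * (2 * pi) + d * (2 * pi)" by simp
  ultimately show ?thesis
    unfolding circle_primitive_def Let_def by linarith
qed

subsection \<open>The energy level of a given mean momentum\<close>

locale circle_potential =
  fixes f :: "real \<Rightarrow> real"
  assumes periodic: "periodic_fun_simple f (2 * pi)"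
    and continuous: "continuous_on UNIV f"
begin

lemma attains_max: obtains b where "b \<in> {0..2 * pi}" "\<And>x. f x \<le> f b"
proof -
  have "\<exists>b\<in>{0..2 * pi}. \<forall>x\<in>{0..2 * pi}. f x \<le> f b"
    using continuous by (intro continuous_attains_sup) (auto intro: continuous_on_subset)
  then show ?thesis using that periodic_rmod[OF periodic] rmod_mem by metis
qed

lemma attains_min: obtains a where "a \<in> {0..2 * pi}" "\<And>x. f a \<le> f x"
proof -
  have "\<exists>a\<in>{0..2 * pi}. \<forall>x\<in>{0..2 * pi}. f a \<le> f x"
    using continuous by (intro continuous_attains_inf) (auto intro: continuous_on_subset)
  then show ?thesis using that periodic_rmod[OF periodic] rmod_mem by metis
qed

lemma Sup_eq_max: "\<exists>b\<in>{0..2 * pi}. (\<forall>x. f x \<le> f b) \<and> (SUP x. f x) = f b"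
proof -
  obtain b where b: "b \<in> {0..2 * pi}" "\<And>x. f x \<le> f b" using attains_max by blast
  then have "(SUP x. f x) = f b"
    by (intro cSup_eq_maximum) auto
  then show ?thesis using b by blast
qed

definition mean :: "(real \<Rightarrow> real) \<Rightarrow> real \<Rightarrow> real" where
  "mean g c = 1 / (2 * pi) * integral {0..2 * pi} (\<lambda>x. g (c - f x))"

end

text \<open>Properties shared by \<open>momentum k\<close> and \<open>momentum_0\<close>, so that
  both kinds of level are treated at once. Strict growth is required only towards positive values,
  since \<open>momentum_0\<close> vanishes on the negative half-line.\<close>

locale momentum_profile = circle_potential +
  fixes g :: "real \<Rightarrow> real"
  assumes g_continuous: "continuous_on UNIV g"
    and g_nonneg: "\<And>s. 0 \<le> g s"
    and g_mono: "\<And>s t. s \<le> t \<Longrightarrow> g s \<le> g t"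
    and g_strict: "\<And>s t. s < t \<Longrightarrow> 0 < g t \<Longrightarrow> g s < g t"
    and g_surj: "\<And>x. 0 < x \<Longrightarrow> \<exists>s. g s = x"
begin

lemma profile_continuous: "continuous_on A (\<lambda>x. g (c - f x))"
  by (rule continuous_on_compose2[OF g_continuous])
     (auto intro!: continuous_intros continuous_on_subset[OF continuous])

lemma profile_periodic: "periodic_fun_simple (\<lambda>x. g (c - f x)) (2 * pi)"
  using periodic_fun_simple.plus_period[OF periodic] by unfold_locales simp

lemma profile_integrable: "(\<lambda>x. g (c - f x)) integrable_on {a..b}"
  by (intro integrable_continuous_interval profile_continuous)

lemma mean_continuous: "continuous_on UNIV (mean g)"
proof -
  have "continuous_on (UNIV \<times> cbox 0 (2 * pi)) (\<lambda>(c, x). g (c - f x))"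
    unfolding case_prod_unfold
    by (rule continuous_on_compose2[OF g_continuous])
       (auto intro!: continuous_intros continuous_on_compose2[OF continuous])
  from integral_continuous_on_param[OF this] show ?thesis
    unfolding mean_def by (auto intro!: continuous_intros)
qed

lemma mean_mono: "c \<le> c' \<Longrightarrow> mean g c \<le> mean g c'"
  unfolding mean_def by (intro mult_left_mono integral_le profile_integrable g_mono) auto

text \<open>A positive mean forces a positive value at some point. There the integrand grows
  strictly, and a continuous nonnegative function that is positive somewhere has positive
  integral.\<close>

lemma mean_strict:
  assumes "c < c'" "0 < mean g c'"
  shows "mean g c < mean g c'"
proof -
  let ?d = "\<lambda>x. g (c' - f x) - g (c - f x)"
  have "\<exists>x\<in>{0..2 * pi}. 0 < g (c' - f x)"
  proof (rule ccontr)
    assume "\<not> ?thesis"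
    then have "integral {0..2 * pi} (\<lambda>x. g (c' - f x)) \<le> integral {0..2 * pi} (\<lambda>x. 0)"
      by (intro integral_le profile_integrable) (auto simp: not_less)
    with assms(2) show False by (simp add: mean_def zero_less_divide_iff)
  qed
  then obtain x where x: "x \<in> {0..2 * pi}" "0 < g (c' - f x)" by blast
  have "0 < ?d x" using g_strict[of "c - f x" "c' - f x"] x assms by simp
  moreover have nonneg: "0 \<le> ?d y" for y using g_mono[of "c - f y" "c' - f y"] assms by simp
  moreover have "continuous_on {0..2 * pi} ?d"
    by (intro continuous_on_diff profile_continuous)
  ultimately have "integral {0..2 * pi} ?d \<noteq> 0"
    using x integral_eq_0_iff[of 0 "2 * pi" ?d] by force
  moreover have "0 \<le> integral {0..2 * pi} ?d"
    by (intro integral_nonneg integrable_diff profile_integrable nonneg)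
  ultimately have "0 < integral {0..2 * pi} ?d" by simp
  then show ?thesis
    by (simp add: mean_def Henstock_Kurzweil_Integration.integral_diff profile_integrable divide_strict_right_mono)
qed

text \<open>If g s = I, then c - f lies below s for c = min f + s and above s for c = max f + s, so
  the mean crosses I in between.\<close>

lemma ex1_level:
  assumes "0 < I"
  shows "\<exists>!c. I = mean g c"
proof (rule ex_ex1I)
  obtain s where s: "g s = I" using g_surj assms by blast
  obtain a where a: "\<And>x. f a \<le> f x" using attains_min by blast
  obtain b where b: "\<And>x. f x \<le> f b" using attains_max by blast
  have const: "1 / (2 * pi) * integral {0..2 * pi} (\<lambda>x. I) = I" by simp
  have "mean g (f a + s) \<le> 1 / (2 * pi) * integral {0..2 * pi} (\<lambda>x. I)"
    unfolding mean_def using a s by (intro mult_left_mono integral_le profile_integrable) (auto intro!: g_mono)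
  moreover have "1 / (2 * pi) * integral {0..2 * pi} (\<lambda>x. I) \<le> mean g (f b + s)"
    unfolding mean_def using b s by (intro mult_left_mono integral_le profile_integrable) (auto intro!: g_mono)
  ultimately have "\<exists>c\<ge>f a + s. c \<le> f b + s \<and> mean g c = I"
    unfolding const using a[of b] by (intro IVT' continuous_on_subset[OF mean_continuous]) auto
  then show "\<exists>c. I = mean g c" by blast
  show "c = c'" if "I = mean g c" "I = mean g c'" for c c'
    using mean_strict[of c c'] mean_strict[of c' c] that assms by (cases c c' rule: linorder_cases) auto
qed

lemma mean_level: "0 < I \<Longrightarrow> mean g (THE c. I = mean g c) = I"
  using theI'[OF ex1_level] by metis

lemma integral_profile_level:
  "0 < I \<Longrightarrow> integral {0..2 * pi} (\<lambda>x. g ((THE c. I = mean g c) - f x)) = 2 * pi * I"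
  using mean_level[of I] by (simp add: mean_def field_simps)

end

lemma (in circle_potential) momentum_profile_momentum:
  assumes "k \<ge> 1" shows "momentum_profile f (momentum k)"
proof
  show "momentum k s \<le> momentum k t" if "s \<le> t" for s t
    using momentum_strict_mono[OF assms, of s t] that by (cases "s = t") auto
  show "\<exists>s. momentum k s = x" if "0 < x" for x
    using momentum_energy assms that by blast
  show "0 \<le> momentum k s" for s
    using momentum_pos[OF assms] by (rule less_imp_le)
qed (use assms in \<open>auto simp: continuous_on_momentum momentum_strict_mono\<close>)

sublocale circle_potential \<subseteq> zero: momentum_profile f momentum_0
proof
  show "momentum_0 s < momentum_0 t" if "s < t" "0 < momentum_0 t" for s t
    using that by (intro momentum_0_strict_mono) (auto simp: momentum_0_def)
  show "\<exists>s. momentum_0 s = x" if "0 < x" for x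
    using momentum_0_half_square[of x] that by auto
qed (auto simp: continuous_on_momentum_0 momentum_0_nonneg momentum_0_mono)

subsection \<open>Convergence of the energy levels\<close>

lemma (in circle_potential) c_k_eq: "c_k f k I = (THE c. I = mean (momentum k) c)"
  by (simp add: c_k_def mean_def gamma_k_eq[abs_def])

lemma (in circle_potential) c_0_eq: "c_0 f I = (THE c. I = mean momentum_0 c)"
  by (simp add: c_0_def mean_def gamma_0_eq[abs_def])

lemma (in circle_potential) mean_momentum_tendsto:
  "(\<lambda>k. mean (momentum k) c) \<longlonglongrightarrow> mean momentum_0 c"
proof (rule tendstoI)
  fix e :: real assume e: "0 < e"
  have "\<forall>\<^sub>F k in sequentially. \<forall>s\<in>UNIV. dist (momentum k s) (momentum_0 s) < e / 2"
    using e by (intro uniform_limitD[OF momentum_uniform_limit]) simp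
  then show "\<forall>\<^sub>F k in sequentially. dist (mean (momentum k) c) (mean momentum_0 c) < e"
    using eventually_ge_at_top[of 1]
  proof eventually_elim
    case (elim k)
    interpret k: momentum_profile f "momentum k"
      using elim by (intro momentum_profile_momentum)
    have "\<bar>integral {0..2 * pi} (\<lambda>x. momentum k (c - f x)) -
        integral {0..2 * pi} (\<lambda>x. momentum_0 (c - f x))\<bar> \<le> e / 2 * (2 * pi)"
      using elim by (intro integral_diff_le k.profile_continuous zero.profile_continuous)
        (auto simp: dist_real_def intro: less_imp_le)
    then have "\<bar>mean (momentum k) c - mean momentum_0 c\<bar> \<le> e / 2"
      by (simp add: mean_def abs_le_iff field_simps)
    then show ?case using e by (simp add: dist_real_def)
  qed
qed

section \<open>The solution at a fixed mean momentum I > 0\<close>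

locale circle_level = circle_potential +
  fixes I :: real
  assumes I_pos: "0 < I"
begin

text \<open>For k >= 1 this is the total momentum I + du/d\<phi> of \<open>u_k\<close>, see
  \<open>deriv_u_k\<close>.\<close>

abbreviation p where "p k \<equiv> gamma_k f k (c_k f k I)"
abbreviation p0 where "p0 \<equiv> gamma_0 f (c_0 f I)"

lemma mean_c_0: "mean momentum_0 (c_0 f I) = I"
  using zero.mean_level[OF I_pos] by (simp add: c_0_eq)

lemma p0_continuous: "continuous_on A p0"
  using zero.profile_continuous by (simp add: gamma_0_eq[abs_def])

lemma p0_nonneg: "0 \<le> p0 x"
  by (simp add: gamma_0_eq momentum_0_nonneg)

context
  fixes k :: nat
  assumes k: "k \<ge> 1"
begin

interpretation k: momentum_profile f "momentum k"
  using k by (rule momentum_profile_momentum)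

lemma mean_c_k: "mean (momentum k) (c_k f k I) = I"
  using k.mean_level[OF I_pos] by (simp add: c_k_eq)

lemma p_continuous: "continuous_on A (p k)"
  using k.profile_continuous by (simp add: gamma_k_eq[abs_def])

lemma p_periodic: "periodic_fun_simple (p k) (2 * pi)"
  using k.profile_periodic by (simp add: gamma_k_eq[abs_def])

lemma p_pos: "0 < p k x"
  using k by (simp add: gamma_k_eq momentum_pos)

lemma integral_p: "integral {0..2 * pi} (p k) = 2 * pi * I"
  using k.integral_profile_level[OF I_pos] by (simp add: gamma_k_eq[abs_def] c_k_eq)

lemma energy_p: "(p k x)\<^sup>2 / 2 + f x = c_k f k I - ln (p k x) / real k"
  using energy_momentum[OF k, of "c_k f k I - f x"] by (simp add: gamma_k_eq energy_def)

lemma exp_energy_p: "exp (real k * ((p k x)\<^sup>2 / 2 + f x)) = exp (real k * c_k f k I) / p k x"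
  using k p_pos by (simp add: energy_p right_diff_distrib exp_diff)

lemma u_k_has_derivative: "(u_k f k I has_real_derivative p k x - I) (at x)"
  unfolding u_k_def
  by (rule circle_primitive_has_derivative[OF p_continuous p_periodic integral_p])

lemma deriv_u_k: "deriv (u_k f k I) x = p k x - I"
  by (rule DERIV_imp_deriv[OF u_k_has_derivative])

text \<open>One derivative is gained because \<open>u_k\<close> is a primitive of a smooth function
  of \<open>c_k - f\<close>.\<close>

lemma C_diff_u_k:
  assumes "C_diff m f"
  shows "C_diff (Suc m) (u_k f k I)"
proof (rule C_diff_Suc_real[OF u_k_has_derivative])
  show "C_diff m (\<lambda>x. p k x - I)"
    unfolding gamma_k_eq
    by (intro C_diff_diff C_diff_momentum_compose C_diff_const assms k)
qed

lemma integral_u_k: "integral {0..2 * pi} (u_k f k I) = 0"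
  unfolding u_k_def
  by (rule integral_circle_primitive[OF p_continuous p_periodic integral_p])

text \<open>The Lagrangian does not contain v, so its p-derivative must be constant along the
  solution. It equals k p exp (k H), and \<open>exp_energy_p\<close> cancels the factor p.\<close>

lemma euler_lagrange_u_k:
  "euler_lagrange (\<lambda>v p \<phi>. exp (real k * hamiltonian f (I + p) \<phi>)) (u_k f k I)"
proof -
  have "deriv (\<lambda>q. exp (real k * hamiltonian f (I + q) t)) (p k t - I) = real k * exp (real k * c_k f k I)" for t
  proof (rule DERIV_imp_deriv)
    have "((\<lambda>q. exp (real k * hamiltonian f (I + q) t)) has_real_derivative
        exp (real k * ((p k t)\<^sup>2 / 2 + f t)) * (real k * p k t)) (at (p k t - I))"
      unfolding hamiltonian_def by (auto intro!: derivative_eq_intros)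
    then show "((\<lambda>q. exp (real k * hamiltonian f (I + q) t)) has_real_derivative
        real k * exp (real k * c_k f k I)) (at (p k t - I))"
      unfolding exp_energy_p using p_pos[of t] by (simp add: mult.commute)
  qed
  then show ?thesis by (simp add: euler_lagrange_def deriv_u_k)
qed

section \<open>The normalising integral and the density \<open>sigma_k\<close>\<close>

lemma inverse_p_continuous: "continuous_on A (\<lambda>x. 1 / p k x)"
  using p_pos by (intro continuous_on_divide p_continuous continuous_on_const)
    (auto simp: less_imp_neq[symmetric])

lemma inverse_p_integrable: "(\<lambda>x. 1 / p k x) integrable_on {a..b}"
  by (intro integrable_continuous_interval inverse_p_continuous)

lemma flux_constant:
  "((\<lambda>t. sigma_k f k I t * deriv (\<lambda>J. hamiltonian f J t) (I + deriv (u_k f k I) t))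
     has_real_derivative 0) (at x)"
proof -
  have "deriv (\<lambda>J. hamiltonian f J t) J = J" for t J
    unfolding hamiltonian_def by (rule DERIV_imp_deriv) (auto intro!: derivative_eq_intros)
  then have "sigma_k f k I t * deriv (\<lambda>J. hamiltonian f J t) (I + deriv (u_k f k I) t) =
      1 / integral {0..2 * pi} (\<lambda>x. 1 / p k x)" for t
    using p_pos[of t] by (simp add: sigma_k_def deriv_u_k)
  then show ?thesis by simp
qed

lemma integral_inverse_p_lower:
  assumes "0 \<le> \<alpha>" "\<alpha> < \<beta>" "\<beta> \<le> 2 * pi" "0 < M" "\<And>x. x \<in> {\<alpha>..\<beta>} \<Longrightarrow> M \<le> 1 / p k x"
  shows "(\<beta> - \<alpha>) * M \<le> integral {0..2 * pi} (\<lambda>x. 1 / p k x)"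
proof -
  have "(\<beta> - \<alpha>) * M = integral {\<alpha>..\<beta>} (\<lambda>x. M)" using assms by simp
  also have "\<dots> \<le> integral {\<alpha>..\<beta>} (\<lambda>x. 1 / p k x)"
    using assms by (intro integral_le inverse_p_integrable) auto
  also have "\<dots> \<le> integral {0..2 * pi} (\<lambda>x. 1 / p k x)"
    using assms p_pos by (intro integral_subset_le inverse_p_integrable) (auto intro: less_imp_le)
  finally show ?thesis .
qed

lemma integral_inverse_p_pos: "0 < integral {0..2 * pi} (\<lambda>x. 1 / p k x)"
proof -
  have pos: "0 < 1 / p k x" for x using p_pos[of x] by simp
  have "integral {0..2 * pi} (\<lambda>x. 1 / p k x) \<noteq> 0"
    using integral_eq_0_iff[OF inverse_p_continuous, of 0 "2 * pi"] pos[of 0] pos[THEN less_imp_le]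
    by auto
  moreover have "0 \<le> integral {0..2 * pi} (\<lambda>x. 1 / p k x)"
    by (intro integral_nonneg inverse_p_integrable pos[THEN less_imp_le])
  ultimately show ?thesis by simp
qed

lemma inverse_p_eq: "1 / p k x = exp (real k * (hamiltonian f (p k x) x - c_k f k I))"
  using exp_energy_p[of x] by (simp add: hamiltonian_def right_diff_distrib exp_diff)

lemma sigma_k_pos: "0 < sigma_k f k I x"
  using p_pos integral_inverse_p_pos by (simp add: sigma_k_def)

lemma sigma_k_has_integral: "(sigma_k f k I has_integral 1) {0..2 * pi}"
  using has_integral_divide[OF integrable_integral[OF inverse_p_integrable[of 0 "2 * pi"]],
      of "integral {0..2 * pi} (\<lambda>x. 1 / p k x)"] integral_inverse_p_pos
  by (simp add: sigma_k_def[abs_def])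

text \<open>Taking logarithms in \<open>\<sigma>\<^sub>k = exp (k (H - Hbar\<^sub>k))\<close>: the mean of the energy exceeds
  \<open>Hbar\<^sub>k\<close> by \<open>1 / k\<close> times the negative entropy of \<open>\<sigma>\<^sub>k\<close>, which is bounded below.\<close>

lemma hamiltonian_eq: "hamiltonian f (p k x) x = Hbar_k f k I + ln (sigma_k f k I x) / real k"
proof -
  have "ln (sigma_k f k I x) = - ln (p k x) - ln (integral {0..2 * pi} (\<lambda>x. 1 / p k x))"
    using p_pos[of x] integral_inverse_p_pos by (simp add: sigma_k_def ln_div ln_mult)
  then show ?thesis
    by (simp add: Hbar_k_def hamiltonian_def energy_p diff_divide_distrib)
qed

lemma energy_density_integrable:
  "(\<lambda>x. hamiltonian f (p k x) x * sigma_k f k I x) integrable_on {0..2 * pi}"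
  unfolding sigma_k_def hamiltonian_def using p_pos integral_inverse_p_pos
  by (intro integrable_continuous_interval continuous_intros p_continuous
      continuous_on_subset[OF continuous])
     (auto simp: less_imp_neq[symmetric])

text \<open>The entropy integrand satisfies \<sigma> ln \<sigma> >= \<sigma> - 1. Since \<sigma> has
  integral 1 over an interval of length 2 pi, the right-hand side integrates to 1 - 2 pi.\<close>

lemma mean_energy_lower:
  "Hbar_k f k I + (1 - 2 * pi) / real k
    \<le> integral {0..2 * pi} (\<lambda>x. hamiltonian f (p k x) x * sigma_k f k I x)"
proof (rule has_integral_le)
  let ?\<sigma> = "sigma_k f k I"
  show "((\<lambda>x. Hbar_k f k I * ?\<sigma> x + (?\<sigma> x - 1) / real k) has_integral
      Hbar_k f k I + (1 - 2 * pi) / real k) {0..2 * pi}"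
  proof -
    have const: "((\<lambda>x. 1) has_integral 2 * pi) {0..2 * pi}"
      using has_integral_const_real[of "1::real" 0 "2 * pi"] by simp
    have "((\<lambda>x. Hbar_k f k I * ?\<sigma> x + (?\<sigma> x - 1) / real k) has_integral
        Hbar_k f k I * 1 + (1 - 2 * pi) / real k) {0..2 * pi}"
      by (intro has_integral_add has_integral_mult_right has_integral_divide has_integral_diff
          sigma_k_has_integral const)
    then show ?thesis by simp
  qed
  show "((\<lambda>x. hamiltonian f (p k x) x * ?\<sigma> x) has_integral
      integral {0..2 * pi} (\<lambda>x. hamiltonian f (p k x) x * ?\<sigma> x)) {0..2 * pi}"
    by (intro integrable_integral energy_density_integrable)
  show "Hbar_k f k I * ?\<sigma> x + (?\<sigma> x - 1) / real k \<le> hamiltonian f (p k x) x * ?\<sigma> x" for x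
  proof -
    \<comment> \<open>This is ln y <= y - 1 at y = 1 / \<sigma>.\<close>
    have "1 - 1 / ?\<sigma> x \<le> ln (?\<sigma> x)"
      using ln_le_minus_one[of "1 / ?\<sigma> x"] sigma_k_pos[of x] by (simp add: ln_div)
    then have "?\<sigma> x - 1 \<le> ln (?\<sigma> x) * ?\<sigma> x"
      using sigma_k_pos[of x] by (simp add: field_simps)
    then have "(?\<sigma> x - 1) / real k \<le> ln (?\<sigma> x) * ?\<sigma> x / real k"
      by (rule divide_right_mono) simp
    then show ?thesis by (simp add: hamiltonian_eq algebra_simps)
  qed
qed

lemma mean_energy_upper:
  assumes "\<And>x. hamiltonian f (p k x) x \<le> M"
  shows "integral {0..2 * pi} (\<lambda>x. hamiltonian f (p k x) x * sigma_k f k I x) \<le> M"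
proof (rule has_integral_le)
  show "((\<lambda>x. hamiltonian f (p k x) x * sigma_k f k I x) has_integral
      integral {0..2 * pi} (\<lambda>x. hamiltonian f (p k x) x * sigma_k f k I x)) {0..2 * pi}"
    by (intro integrable_integral energy_density_integrable)
  show "((\<lambda>x. M * sigma_k f k I x) has_integral M) {0..2 * pi}"
    using has_integral_mult_right[OF sigma_k_has_integral, of M] by simp
qed (use assms sigma_k_pos in \<open>simp add: mult_right_mono less_imp_le\<close>)

end

section \<open>Limits of the levels, momenta and energies\<close>

lemma c_k_tendsto: "(\<lambda>k. c_k f k I) \<longlonglongrightarrow> c_0 f I"
proof (rule order_tendstoI)
  fix a assume a: "a < c_0 f I"
  \<comment> \<open>A strict inequality at the fixed level a passes to
    \<open>mean (momentum k) a\<close> for large k. Monotonicity of that mean then places a below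
    \<open>c_k\<close>.\<close>
  have "mean momentum_0 a < I"
    using zero.mean_strict[OF a] mean_c_0 I_pos by simp
  with mean_momentum_tendsto have "\<forall>\<^sub>F k in sequentially. mean (momentum k) a < I"
    by (rule order_tendstoD)
  then show "\<forall>\<^sub>F k in sequentially. a < c_k f k I"
    using eventually_ge_at_top[of 1]
  proof eventually_elim
    case (elim k)
    then interpret k: momentum_profile f "momentum k" by (intro momentum_profile_momentum)
    show ?case using k.mean_mono[of "c_k f k I" a] mean_c_k elim by (cases "a < c_k f k I") auto
  qed
next
  fix a assume a: "c_0 f I < a"
  have "I < mean momentum_0 a"
    using zero.mean_strict[OF a] zero.mean_mono[of "c_0 f I" a] a mean_c_0 I_pos by simp
  with mean_momentum_tendsto have "\<forall>\<^sub>F k in sequentially. I < mean (momentum k) a"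
    by (rule order_tendstoD)
  then show "\<forall>\<^sub>F k in sequentially. c_k f k I < a"
    using eventually_ge_at_top[of 1]
  proof eventually_elim
    case (elim k)
    then interpret k: momentum_profile f "momentum k" by (intro momentum_profile_momentum)
    show ?case using k.mean_mono[of a "c_k f k I"] mean_c_k elim by (cases "c_k f k I < a") auto
  qed
qed

text \<open>First \<open>momentum k\<close> is exchanged for \<open>momentum_0\<close> at the moving
  level \<open>c_k\<close>, which uniformity in s permits; then the level is moved to
  \<open>c_0\<close> by the Hoelder bound.\<close>

lemma p_uniform_limit: "uniform_limit UNIV p p0 sequentially"
proof (rule uniform_limitI)
  fix e :: real assume e: "0 < e"
  have "(\<lambda>k. sqrt (2 * \<bar>c_k f k I - c_0 f I\<bar>)) \<longlonglongrightarrow> sqrt (2 * \<bar>c_0 f I - c_0 f I\<bar>)"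
    by (intro tendsto_intros c_k_tendsto)
  then have "\<forall>\<^sub>F k in sequentially. sqrt (2 * \<bar>c_k f k I - c_0 f I\<bar>) < e / 2"
    using e by (intro order_tendstoD) auto
  moreover have "\<forall>\<^sub>F k in sequentially. \<forall>s\<in>UNIV. dist (momentum k s) (momentum_0 s) < e / 2"
    using e by (intro uniform_limitD[OF momentum_uniform_limit]) simp
  ultimately show "\<forall>\<^sub>F k in sequentially. \<forall>x\<in>UNIV. dist (p k x) (p0 x) < e"
  proof eventually_elim
    case (elim k)
    show ?case
    proof
      fix x
      have "\<bar>momentum k (c_k f k I - f x) - momentum_0 (c_k f k I - f x)\<bar> < e / 2"
        using elim by (simp add: dist_real_def)
      moreover have "\<bar>momentum_0 (c_k f k I - f x) - momentum_0 (c_0 f I - f x)\<bar> < e / 2"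
        using elim momentum_0_diff_le[of "c_k f k I - f x" "c_0 f I - f x"] by simp
      ultimately show "dist (p k x) (p0 x) < e"
        unfolding gamma_k_eq gamma_0_eq dist_real_def by linarith
    qed
  qed
qed

lemma u_k_uniform_limit: "uniform_limit UNIV (\<lambda>k. u_k f k I) (u_0 f I) sequentially"
proof (rule uniform_limitI)
  fix e :: real assume e: "0 < e"
  have "\<forall>\<^sub>F k in sequentially. \<forall>x\<in>UNIV. dist (p k x) (p0 x) < e / (8 * pi)"
    using e by (intro uniform_limitD[OF p_uniform_limit]) simp
  then show "\<forall>\<^sub>F k in sequentially. \<forall>x\<in>UNIV. dist (u_k f k I x) (u_0 f I x) < e"
    using eventually_ge_at_top[of 1]
  proof eventually_elim
    case (elim k)
    have "\<bar>u_k f k I x - u_0 f I x\<bar> \<le> 4 * pi * (e / (8 * pi))" for x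
      unfolding u_k_def u_0_def using elim
      by (intro circle_primitive_diff_le p_continuous p0_continuous)
         (auto simp: dist_real_def intro: less_imp_le)
    then have "\<bar>u_k f k I x - u_0 f I x\<bar> \<le> e / 2" for x by simp
    moreover have "e / 2 < e" using e by simp
    ultimately show ?case unfolding dist_real_def by (blast intro: le_less_trans)
  qed
qed

lemma hamiltonian_uniform_limit:
  "uniform_limit UNIV (\<lambda>k x. hamiltonian f (p k x) x) (\<lambda>x. max (c_0 f I) (f x)) sequentially"
proof -
  obtain a where a: "\<And>x. f a \<le> f x" using attains_min by blast
  have "p0 x \<le> momentum_0 (c_0 f I - f a)" for x
    unfolding gamma_0_eq using a by (intro momentum_0_mono) simp
  \<comment> \<open>Products preserve uniform convergence only when the limits are bounded.\<close>
  then have bounded: "bounded (range p0)"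
    using p0_nonneg by (intro boundedI[where B = "momentum_0 (c_0 f I - f a)"]) auto
  have "uniform_limit UNIV (\<lambda>k x. p k x * p k x) (\<lambda>x. p0 x * p0 x) sequentially"
    by (intro uniform_lim_mult p_uniform_limit bounded)
  then have "uniform_limit UNIV (\<lambda>k x. (1 / 2) * (p k x * p k x) + f x)
      (\<lambda>x. (1 / 2) * (p0 x * p0 x) + f x) sequentially"
    by (intro uniform_limit_add bounded_linear.uniform_limit[OF bounded_linear_mult_right]
        uniform_limit_const)
  moreover have "(1 / 2) * (p0 x * p0 x) + f x = max (c_0 f I) (f x)" for x
    using momentum_0_square[of "c_0 f I - f x"] by (simp add: gamma_0_eq power2_eq_square max_def)
  ultimately show ?thesis by (simp add: hamiltonian_def power2_eq_square)
qed

section \<open>Laplace asymptotics of the effective Hamiltonian\<close>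

lemma Hbar_eq: "\<exists>b\<in>{0..2 * pi}. (\<forall>x. f x \<le> f b) \<and> Hbar f I = max (c_0 f I) (f b)"
  using Sup_eq_max by (auto simp: Hbar_def max_def)

lemma eventually_hamiltonian_le:
  assumes "0 < e"
  shows "\<forall>\<^sub>F k in sequentially. \<forall>x. hamiltonian f (p k x) x \<le> Hbar f I + e"
proof -
  obtain b where b: "\<And>x. f x \<le> f b" "Hbar f I = max (c_0 f I) (f b)" using Hbar_eq by blast
  have "\<forall>\<^sub>F k in sequentially. \<forall>x\<in>UNIV. dist (hamiltonian f (p k x) x) (max (c_0 f I) (f x)) < e"
    by (rule uniform_limitD[OF hamiltonian_uniform_limit assms])
  then show ?thesis
  proof eventually_elim
    case (elim k)
    show ?case
    proof
      fix x
      have "\<bar>hamiltonian f (p k x) x - max (c_0 f I) (f x)\<bar> < e"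
        using elim by (simp add: dist_real_def)
      then show "hamiltonian f (p k x) x \<le> Hbar f I + e" using b(1)[of x] b(2) by linarith
    qed
  qed
qed

text \<open>The limit energy max c f attains \<open>Hbar\<close> at a maximum point of f, and by
  continuity it stays close on an interval of positive length independent of k.\<close>

lemma eventually_le_hamiltonian:
  assumes "0 < e"
  obtains \<alpha> \<beta> where "0 \<le> \<alpha>" "\<alpha> < \<beta>" "\<beta> \<le> 2 * pi"
    "\<forall>\<^sub>F k in sequentially. \<forall>x\<in>{\<alpha>..\<beta>}. Hbar f I - e \<le> hamiltonian f (p k x) x"
proof -
  obtain b where b: "b \<in> {0..2 * pi}" "Hbar f I = max (c_0 f I) (f b)" using Hbar_eq by blast
  have "isCont f b" using continuous by (simp add: continuous_on_eq_continuous_at)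
  then have "\<exists>d>0. \<forall>x. dist x b < d \<longrightarrow> dist (f x) (f b) < e / 2"
    using assms unfolding continuous_at_eps_delta by (meson half_gt_zero)
  then obtain d where d: "0 < d" "\<And>x. \<bar>x - b\<bar> < d \<Longrightarrow> \<bar>f x - f b\<bar> < e / 2"
    by (auto simp: dist_real_def)
  \<comment> \<open>Clipping to [0, 2 pi] keeps positive length even when b is an endpoint.\<close>
  define \<alpha> where "\<alpha> = max 0 (b - d / 2)"
  define \<beta> where "\<beta> = min (2 * pi) (b + d / 2)"
  have "\<forall>\<^sub>F k in sequentially. \<forall>x\<in>UNIV. dist (hamiltonian f (p k x) x) (max (c_0 f I) (f x)) < e / 2"
    using assms by (intro uniform_limitD[OF hamiltonian_uniform_limit]) simp
  then have "\<forall>\<^sub>F k in sequentially. \<forall>x\<in>{\<alpha>..\<beta>}. Hbar f I - e \<le> hamiltonian f (p k x) x"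
  proof eventually_elim
    case (elim k)
    show ?case
    proof
      fix x assume "x \<in> {\<alpha>..\<beta>}"
      then have "\<bar>x - b\<bar> < d" using d(1) by (auto simp: \<alpha>_def \<beta>_def)
      then have "\<bar>f x - f b\<bar> < e / 2" by (rule d(2))
      moreover have "\<bar>hamiltonian f (p k x) x - max (c_0 f I) (f x)\<bar> < e / 2"
        using elim by (simp add: dist_real_def)
      ultimately show "Hbar f I - e \<le> hamiltonian f (p k x) x" using b(2) by linarith
    qed
  qed
  moreover have "0 \<le> \<alpha>" "\<alpha> < \<beta>" "\<beta> \<le> 2 * pi" using b d(1) by (auto simp: \<alpha>_def \<beta>_def)
  ultimately show ?thesis using that by blast
qed

text \<open>Laplace's method: \<open>Hbar\<^sub>k = 1/k ln \<integral> exp (k H)\<close> tends to the maximum of the limiting \<open>H\<close>.\<close>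

lemma Hbar_k_tendsto: "(\<lambda>k. Hbar_k f k I) \<longlonglongrightarrow> Hbar f I"
proof (rule tendstoI)
  fix e :: real assume e: "0 < e"
  then have e2: "0 < e / 2" by simp
  obtain \<alpha> \<beta> where ab: "0 \<le> \<alpha>" "\<alpha> < \<beta>" "\<beta> \<le> 2 * pi"
    and lower: "\<forall>\<^sub>F k in sequentially. \<forall>x\<in>{\<alpha>..\<beta>}. Hbar f I - e / 2 \<le> hamiltonian f (p k x) x"
    by (rule eventually_le_hamiltonian[OF e2]) (rule that)
  have upper: "\<forall>\<^sub>F k in sequentially. \<forall>x. hamiltonian f (p k x) x \<le> Hbar f I + e / 2"
    using e by (intro eventually_hamiltonian_le) simp
  \<comment> \<open>Used for the logarithms of the interval lengths 2 pi and \<beta> - \<alpha>, the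
    only errors left after dividing by k.\<close>
  have small: "\<forall>\<^sub>F k in sequentially. \<bar>C / real k\<bar> < e / 2" for C
    using tendstoD[OF lim_const_over_n[of C], of "e / 2"] e by (simp add: dist_real_def)
  show "\<forall>\<^sub>F k in sequentially. dist (Hbar_k f k I) (Hbar f I) < e"
    using lower upper small[of "ln (2 * pi)"] small[of "ln (\<beta> - \<alpha>)"] eventually_ge_at_top[of 1]
  proof eventually_elim
    case (elim k)
    then have k: "0 < real k" by simp
    define Z where "Z = integral {0..2 * pi} (\<lambda>x. 1 / p k x)"
    \<comment> \<open>The integrand 1 / p is M at the energy. By \<open>ln_M\<close>, taking (1 / k)
      ln of a bound produces - \<open>c_k\<close>, which cancels the summand \<open>c_k\<close> of
      \<open>Hbar_k\<close>.\<close>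
    define M where "M s = exp (real k * (s - c_k f k I))" for s
    have ln_M: "ln (C * M s) / real k = ln C / real k + (s - c_k f k I)" if "0 < C" for C s
      using that k by (simp add: M_def ln_mult add_divide_distrib)
    have Z: "0 < Z" using integral_inverse_p_pos elim by (simp add: Z_def)
    have p_eq: "1 / p k x = M (hamiltonian f (p k x) x)" for x
      using inverse_p_eq elim by (simp add: M_def)
    have M_mono: "M s \<le> M t" if "s \<le> t" for s t
      using that by (simp add: M_def mult_left_mono)
    have "Z \<le> integral {0..2 * pi} (\<lambda>x. M (Hbar f I + e / 2))"
      unfolding Z_def using elim by (intro integral_le inverse_p_integrable) (auto simp: p_eq M_mono)
    then have "ln Z / real k \<le> ln (2 * pi * M (Hbar f I + e / 2)) / real k"
      using Z by (intro divide_right_mono) auto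
    then have up: "Hbar_k f k I \<le> Hbar f I + e / 2 + ln (2 * pi) / real k"
      by (simp add: ln_M Hbar_k_def flip: Z_def)
    have "(\<beta> - \<alpha>) * M (Hbar f I - e / 2) \<le> Z"
      unfolding Z_def using elim ab by (intro integral_inverse_p_lower) (auto simp: p_eq M_mono, simp add: M_def)
    then have "ln ((\<beta> - \<alpha>) * M (Hbar f I - e / 2)) / real k \<le> ln Z / real k"
      using ab Z by (intro divide_right_mono) (auto simp: M_def)
    then have "Hbar f I - e / 2 + ln (\<beta> - \<alpha>) / real k \<le> Hbar_k f k I"
      using ab by (simp add: ln_M Hbar_k_def flip: Z_def)
    with up show ?case using elim(3,4) unfolding dist_real_def by linarith
  qed
qed

text \<open>The entropy bound reduces the lower estimate to the limit of \<open>Hbar_k\<close>; the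
  upper one follows from the uniform bound on H and the unit mass of \<open>sigma_k\<close>.\<close>

lemma mean_energy_tendsto:
  "(\<lambda>k. integral {0..2 * pi}
      (\<lambda>x. hamiltonian f (I + deriv (u_k f k I) x) x * sigma_k f k I x)) \<longlonglongrightarrow> Hbar f I"
    (is "?A \<longlonglongrightarrow> _")
proof (rule order_tendstoI)
  have A: "?A k = integral {0..2 * pi} (\<lambda>x. hamiltonian f (p k x) x * sigma_k f k I x)" if "k \<ge> 1" for k
    using deriv_u_k[OF that] by simp
  {
    fix a assume "a < Hbar f I"
    moreover have "(\<lambda>k. Hbar_k f k I + (1 - 2 * pi) / real k) \<longlonglongrightarrow> Hbar f I + 0"
      by (intro tendsto_add Hbar_k_tendsto lim_const_over_n)
    ultimately have "\<forall>\<^sub>F k in sequentially. a < Hbar_k f k I + (1 - 2 * pi) / real k"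
      by (intro order_tendstoD) auto
    then show "\<forall>\<^sub>F k in sequentially. a < ?A k"
      using eventually_ge_at_top[of 1]
    proof eventually_elim
      case (elim k)
      then show ?case unfolding A[OF elim(2)] using mean_energy_lower[OF elim(2)] by simp
    qed
  next
    fix a assume a: "Hbar f I < a"
    define e where "e = (a - Hbar f I) / 2"
    have "0 < e" using a by (simp add: e_def)
    from eventually_hamiltonian_le[OF this] show "\<forall>\<^sub>F k in sequentially. ?A k < a"
      using eventually_ge_at_top[of 1]
    proof eventually_elim
      case (elim k)
      then have "?A k \<le> Hbar f I + e" unfolding A[OF elim(2)] by (intro mean_energy_upper) auto
      also have "\<dots> < a" using a by (simp add: e_def field_simps)
      finally show ?case .
    qed
  }
qed

end

theorem theorem3p2:
  fixes f :: "real \<Rightarrow> real"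
  assumes "periodic_fun_simple f (2 * pi)"
    and "C_diff 2 f"
  shows
    \<comment> \<open>(i); "smooth" means: of class \<open>C\<^sup>m\<^sup>+\<^sup>1\<close> as soon as \<open>f\<close> is of class \<open>C\<^sup>m\<close>\<close>
    "(\<forall>I>0.
        (\<forall>k\<ge>1.
           (\<forall>m. C_diff m f \<longrightarrow> C_diff (Suc m) (u_k f k I)) \<and>
           1 / (2 * pi) * integral {0..2 * pi} (u_k f k I) = 0 \<and>
           euler_lagrange (\<lambda>v p \<phi>. exp (real k * hamiltonian f (I + p) \<phi>)) (u_k f k I) \<and>
           (\<forall>\<phi>. ((\<lambda>t. sigma_k f k I t
                        * deriv (\<lambda>J. hamiltonian f J t) (I + deriv (u_k f k I) t))
                   has_real_derivative 0) (at \<phi>))) \<and>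
        uniform_limit UNIV (\<lambda>k. u_k f k I) (u_0 f I) sequentially)
     \<and>
     \<comment> \<open>(ii); \<open>C\<^sup>\<infinity>\<close> in \<open>c\<close>, and jointly of class \<open>C\<^sup>m\<close> as soon as \<open>f\<close> is\<close>
     (\<forall>k\<ge>1.
        (\<forall>\<phi>. C_infty (\<lambda>c. gamma_k f k c \<phi>)) \<and>
        (\<forall>m. C_diff m f \<longrightarrow> C_diff m (\<lambda>(c, \<phi>). gamma_k f k c \<phi>))) \<and>
     (\<forall>c_star. uniform_limit ({..c_star} \<times> UNIV)
        (\<lambda>k (c, \<phi>). gamma_k f k c \<phi>) (\<lambda>(c, \<phi>). gamma_0 f c \<phi>) sequentially)
     \<and>
     \<comment> \<open>(iii)\<close>
     (\<forall>I>0. (\<lambda>k. c_k f k I) \<longlonglongrightarrow> c_0 f I)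
     \<and>
     \<comment> \<open>(iv)\<close>
     (\<forall>I>0.
        (\<lambda>k. integral {0..2 * pi}
               (\<lambda>\<phi>. hamiltonian f (I + deriv (u_k f k I) \<phi>) \<phi> * sigma_k f k I \<phi>))
          \<longlonglongrightarrow> Hbar f I \<and>
        (\<lambda>k. Hbar_k f k I) \<longlonglongrightarrow> Hbar f I)"
proof -
  interpret circle_potential f
    using assms by (simp add: circle_potential_def C_diff_continuous del: C_diff.simps)
  have level: "circle_level f I" if "0 < I" for I
    using that by unfold_locales
  have smooth_c: "C_infty (\<lambda>c. gamma_k f k c \<phi>)" if "k \<ge> 1" for k \<phi>
    unfolding C_infty_def gamma_k_eq using that
    by (intro allI C_diff_momentum_compose C_diff_diff C_diff_const
        C_diff_bounded_linear bounded_linear_ident)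
  have smooth: "C_diff m (\<lambda>(c, \<phi>). gamma_k f k c \<phi>)" if "k \<ge> 1" "C_diff m f" for k m
    unfolding gamma_k_eq case_prod_unfold
    by (rule C_diff_momentum_compose[OF that(1) C_diff_diff[OF
          C_diff_bounded_linear[OF bounded_linear_fst] C_diff_compose_snd[OF that(2)]]])
  \<comment> \<open>Convergence of \<open>momentum k\<close> is uniform in s on the whole line, so
    the substitution s = c - f \<phi> preserves it on any set of pairs.\<close>
  have gamma_limit: "uniform_limit A (\<lambda>k (c, \<phi>). gamma_k f k c \<phi>) (\<lambda>(c, \<phi>). gamma_0 f c \<phi>) sequentially"
    for A
    unfolding gamma_k_eq gamma_0_eq case_prod_unfold
    by (rule uniform_limit_compose'[OF momentum_uniform_limit]) auto
  show ?thesis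
    by (intro conjI allI impI smooth_c smooth gamma_limit)
      (simp_all add: level circle_level.C_diff_u_k circle_level.integral_u_k
        circle_level.euler_lagrange_u_k circle_level.flux_constant circle_level.u_k_uniform_limit
        circle_level.c_k_tendsto circle_level.mean_energy_tendsto circle_level.Hbar_k_tendsto
        del: C_diff.simps)
qed

end
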